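(* Let $n \ge m \ge 2$ be integers. The outcome of the Maker-Breaker domination game on $K_{1,m} \square K_{1,n}$ is $\mathcal{D}$ if $m=n=2$; it is $\mathcal{N}$ if $m=2$ and $n \ge 3$; and it is $\mathcal{S}$ if $n \ge m \ge 3$.
   Context: The Maker-Breaker domination game on a finite graph $G$ is played by Dominator and Staller, who alternately claim a previously unplayed vertex of $G$ until all vertices are played. Dominator wins if his claimed vertices form a dominating set of $G$; otherwise Staller wins (equivalently, she claims all vertices of some closed neighborhood $N_G[v]$). The D-game is the game where Dominator moves first, the S-game where Staller moves first. The outcome $o(G)$ is $\mathcal{D}$ if Dominator has a winning strategy in both the D-game and the S-game, $\mathcal{S}$ if Staller has a winning strategy in both games, and $\mathcal{N}$ if the player who moves first has a winning strategy in each game. $K_{1,k}$ is the star with $k$ leaves and $\square$ is the Cartesian product of graphs. *)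

theory Defs
  imports Main
begin

record 'a ugraph =
  verts :: "'a set"
  adj :: "'a \<Rightarrow> 'a \<Rightarrow> bool"

definition finite_simple_graph :: "'a ugraph \<Rightarrow> bool" where
  "finite_simple_graph G \<longleftrightarrow>
     finite (verts G) \<and>
     (\<forall>u v. adj G u v \<longrightarrow> u \<in> verts G \<and> v \<in> verts G \<and> u \<noteq> v \<and> adj G v u)"

text \<open>The star \<open>K\<^bsub>1,k\<^esub>\<close>, realised on \<open>{0..k}\<close> with centre \<open>0\<close> and leaves \<open>1, \<dots>, k\<close>.\<close>

definition star :: "nat \<Rightarrow> nat ugraph" where
  "star k = \<lparr>verts = {0..k},
     adj = (\<lambda>u v. u \<le> k \<and> v \<le> k \<and> u \<noteq> v \<and> (u = 0 \<or> v = 0))\<rparr>"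

definition cart_prod :: "'a ugraph \<Rightarrow> 'b ugraph \<Rightarrow> ('a \<times> 'b) ugraph" (infixr "\<box>" 70) where
  "G \<box> H = \<lparr>verts = verts G \<times> verts H,
     adj = (\<lambda>(a, b) (c, d).
        (a = c \<and> a \<in> verts G \<and> adj H b d) \<or> (adj G a c \<and> b = d \<and> b \<in> verts H))\<rparr>"

lemma finite_simple_graph_star: "finite_simple_graph (star k)"
  by (auto simp: finite_simple_graph_def star_def)

lemma finite_simple_graph_cart_prod:
  assumes "finite_simple_graph G" and "finite_simple_graph H"
  shows "finite_simple_graph (G \<box> H)"
  using assms by (auto simp: finite_simple_graph_def cart_prod_def)

definition closed_nbhd :: "'a ugraph \<Rightarrow> 'a \<Rightarrow> 'a set" where
  "closed_nbhd G v = insert v {u \<in> verts G. adj G v u}"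

definition dominating_set :: "'a ugraph \<Rightarrow> 'a set \<Rightarrow> bool" where
  "dominating_set G X \<longleftrightarrow>
     X \<subseteq> verts G \<and> (\<forall>v \<in> verts G. closed_nbhd G v \<inter> X \<noteq> {})"

datatype player = Dominator | Staller

fun opponent :: "player \<Rightarrow> player" where
  "opponent Dominator = Staller"
| "opponent Staller = Dominator"

text \<open>
  A (partial) play is the list of the vertices claimed so far, in order; the parameter
  \<open>first\<close> is the player who makes move number \<open>0\<close>. The D-game is \<open>first = Dominator\<close>,
  the S-game is \<open>first = Staller\<close>. All games are meant for finite graphs.
\<close>

definition mover :: "player \<Rightarrow> nat \<Rightarrow> player" where
  "mover first i = (if even i then first else opponent first)"

definition partial_play :: "'a ugraph \<Rightarrow> 'a list \<Rightarrow> bool" where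
  "partial_play G h \<longleftrightarrow> distinct h \<and> set h \<subseteq> verts G"

definition complete_play :: "'a ugraph \<Rightarrow> 'a list \<Rightarrow> bool" where
  "complete_play G h \<longleftrightarrow> distinct h \<and> set h = verts G"

definition claimed :: "player \<Rightarrow> player \<Rightarrow> 'a list \<Rightarrow> 'a set" where
  "claimed first p h = {h ! i | i. i < length h \<and> mover first i = p}"

fun wins_play :: "'a ugraph \<Rightarrow> player \<Rightarrow> player \<Rightarrow> 'a list \<Rightarrow> bool" where
  "wins_play G first Dominator h \<longleftrightarrow> dominating_set G (claimed first Dominator h)"
| "wins_play G first Staller h \<longleftrightarrow> \<not> dominating_set G (claimed first Dominator h)"

text \<open>A strategy maps the history of the play to the next vertex to claim.\<close>

type_synonym 'a strategy = "'a list \<Rightarrow> 'a"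

definition follows :: "player \<Rightarrow> player \<Rightarrow> 'a strategy \<Rightarrow> 'a list \<Rightarrow> bool" where
  "follows first p \<sigma> h \<longleftrightarrow>
     (\<forall>i < length h. mover first i = p \<longrightarrow> h ! i = \<sigma> (take i h))"

text \<open>
  The first conjunct says that the strategy always prescribes a legal move; without it, a
  strategy prescribing illegal moves would win vacuously.
\<close>

definition winning_strategy :: "'a ugraph \<Rightarrow> player \<Rightarrow> player \<Rightarrow> 'a strategy \<Rightarrow> bool" where
  "winning_strategy G first p \<sigma> \<longleftrightarrow>
     (\<forall>h. partial_play G h \<and> set h \<noteq> verts G \<and> follows first p \<sigma> h \<and> mover first (length h) = p
        \<longrightarrow> \<sigma> h \<in> verts G - set h) \<and>
     (\<forall>h. complete_play G h \<and> follows first p \<sigma> h \<longrightarrow> wins_play G first p h)"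

definition has_winning_strategy :: "'a ugraph \<Rightarrow> player \<Rightarrow> player \<Rightarrow> bool" where
  "has_winning_strategy G first p \<longleftrightarrow> (\<exists>\<sigma>. winning_strategy G first p \<sigma>)"

datatype outcome = Outcome_D | Outcome_S | Outcome_N

text \<open>
  \<open>has_outcome G w\<close> renders \<open>o(G) = w\<close>. It is a relation so that each outcome is asserted
  by its own defining condition, with no default case.
\<close>

fun has_outcome :: "'a ugraph \<Rightarrow> outcome \<Rightarrow> bool" where
  "has_outcome G Outcome_D \<longleftrightarrow>
     has_winning_strategy G Dominator Dominator \<and> has_winning_strategy G Staller Dominator"
| "has_outcome G Outcome_S \<longleftrightarrow>
     has_winning_strategy G Dominator Staller \<and> has_winning_strategy G Staller Staller"
| "has_outcome G Outcome_N \<longleftrightarrow>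
     has_winning_strategy G Dominator Dominator \<and> has_winning_strategy G Staller Staller"

end

theory Submission
  imports Defs
begin

text \<open>Write \<open>a\<^sub>i = (i, 0)\<close>, \<open>b\<^sub>j = (0, j)\<close>, \<open>c = (0, 0)\<close> and \<open>x\<^sub>i\<^sub>j = (i, j)\<close> for \<open>i, j \<ge> 1\<close>.
  Suppose Staller is to move, \<open>n \<ge> 3\<close>, and Dominator has nothing in the rows \<open>0\<close>, \<open>i\<close>, \<open>i'\<close>.
  Staller claims \<open>a\<^sub>i\<close>. If Dominator answers \<open>a\<^sub>i\<^sub>'\<close>, she claims \<open>x\<^sub>i\<^sub>1, x\<^sub>i\<^sub>2, \<dots>\<close>, each time threatening
  \<open>{x\<^sub>i\<^sub>j, a\<^sub>i, b\<^sub>j}\<close>, until the last one also threatens to complete row \<open>i\<close> with \<open>c\<close>. Otherwise she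
  claims \<open>a\<^sub>i\<^sub>'\<close> as well, and after Dominator's next move \<open>b\<^sub>j\<close> in a column he has not touched creates
  the double threat \<open>x\<^sub>i\<^sub>j\<close>, \<open>x\<^sub>i\<^sub>'\<^sub>j\<close>. Up to exchanging the factors, this also beats every first move of
  Dominator other than \<open>c\<close> when \<open>m, n \<ge> 3\<close>; against \<open>c\<close> a third row replaces a blocked \<open>a\<^sub>i\<^sub>'\<close>.
  Dominator's wins for \<open>m = 2\<close> come from pairing strategies after his first move.\<close>

section \<open>Positional games\<close>

text \<open>\<open>forces V goal t A B\<close> concerns the game on the board \<open>V\<close> at the position where one player
  owns \<open>A\<close>, the adversary owns \<open>B\<close>, and \<open>t\<close> tells whether the player is to move.\<close>

inductive forces :: "'a set \<Rightarrow> ('a set \<Rightarrow> bool) \<Rightarrow> bool \<Rightarrow> 'a set \<Rightarrow> 'a set \<Rightarrow> bool"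
  for V goal where
  reached: "goal A \<Longrightarrow> forces V goal t A B"
| own_move: "v \<in> V - A - B \<Longrightarrow> forces V goal False (insert v A) B \<Longrightarrow> forces V goal True A B"
| adversary_move: "V - A - B \<noteq> {} \<Longrightarrow> (\<And>v. v \<in> V - A - B \<Longrightarrow> forces V goal True A (insert v B))
    \<Longrightarrow> forces V goal False A B"

lemma forces_full_board:
  assumes "forces V goal t A B" and "V - A - B = {}"
  shows "goal A"
  using assms by cases auto

text \<open>If the goal is already reached, monotonicity makes every free vertex a good move; hence
  a move exists until the board is full.\<close>

lemma forces_own_turn:
  assumes "forces V goal True A B" and "mono goal" and "V - A - B \<noteq> {}"
  obtains v where "v \<in> V - A - B" and "forces V goal False (insert v A) B"
  using assms(1)
proof cases
  case reached
  obtain v where v: "v \<in> V - A - B" using assms(3) by blast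
  have "goal (insert v A)"
    using reached monoD[OF assms(2), of A "insert v A"] by auto
  then show ?thesis using that v forces.reached by metis
next
  case (own_move v)
  then show ?thesis using that by blast
qed simp

lemma forces_adversary_turn:
  assumes "forces V goal False A B" and "v \<in> V - A - B"
  shows "forces V goal True A (insert v B)"
  using assms(1) by cases (use assms(2) in \<open>auto intro: forces.reached\<close>)

lemma forces_winning_move:
  assumes "v \<in> V - A - B" and "goal (insert v A)"
  shows "forces V goal True A B"
  using assms forces.own_move forces.reached by metis

text \<open>Unless the adversary answers at \<open>x\<close>, the player takes \<open>x\<close> and
  is done, so only one continuation matters.\<close>

lemma forces_threat:
  assumes "x \<in> V - A - B" and "goal (insert x A)" and "forces V goal True A (insert x B)"
  shows "forces V goal False A B"
proof (rule forces.adversary_move)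
  show "V - A - B \<noteq> {}" using assms(1) by blast
  fix v assume "v \<in> V - A - B"
  show "forces V goal True A (insert v B)"
  proof (cases "v = x")
    case False
    then have "x \<in> V - A - insert v B" using assms(1) by blast
    then show ?thesis using assms(2) by (rule forces_winning_move)
  qed (use assms(3) in simp)
qed

lemma forces_image:
  assumes "forces V goal t A B" and "inj f" and "\<And>A. goal A \<Longrightarrow> goal' (f ` A)"
  shows "forces (f ` V) goal' t (f ` A) (f ` B)"
  using assms(1)
proof induction
  case (reached A t B)
  then show ?case using assms(3) by (auto intro: forces.reached)
next
  case (own_move v A B)
  show ?case
    by (rule forces.own_move[of "f v"])
      (use own_move assms(2) in \<open>auto simp: inj_image_mem_iff\<close>)
next
  case (adversary_move A B)
  have free: "f ` V - f ` A - f ` B = f ` (V - A - B)"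
    using assms(2) by (simp add: image_set_diff)
  show ?case
    by (rule forces.adversary_move) (use adversary_move in \<open>auto simp: free\<close>)
qed

text \<open>Pairing strategy: the player answers in the pair just touched, so each pair yields at
  least one own vertex, which hits every set of \<open>\<E>\<close> containing the pair.\<close>

lemma forces_pairing:
  assumes "finite V"
    and "\<And>p. p \<in> P \<Longrightarrow> fst p \<in> V - A - B \<and> snd p \<in> V - A - B \<and> fst p \<noteq> snd p"
    and "\<And>p q. p \<in> P \<Longrightarrow> q \<in> P \<Longrightarrow> p \<noteq> q \<Longrightarrow> {fst p, snd p} \<inter> {fst q, snd q} = {}"
    and "\<And>E. E \<in> \<E> \<Longrightarrow> E \<inter> A \<noteq> {} \<or> (\<exists>p \<in> P. fst p \<in> E \<and> snd p \<in> E)"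
  shows "forces V (\<lambda>X. \<forall>E \<in> \<E>. E \<inter> X \<noteq> {}) False A B"
  using assms(2-)
proof (induction "card (V - A - B)" arbitrary: A B P rule: less_induct)
  case less
  let ?goal = "\<lambda>X. \<forall>E \<in> \<E>. E \<inter> X \<noteq> {}"
  have step: "forces V ?goal False (insert w A) (insert v B)"
    if v: "v \<in> V - A - B" and w: "w \<in> V - A - insert v B"
      and vp: "\<And>p. p \<in> P \<Longrightarrow> v = fst p \<Longrightarrow> w = snd p" "\<And>p. p \<in> P \<Longrightarrow> v = snd p \<Longrightarrow> w = fst p"
    for v w
  \<comment> \<open>Only the pairs avoiding \<open>w\<close> survive. A pair touched by
    \<open>v\<close> has \<open>w\<close> as its other end and drops out; every set containing a
    dropped pair is now hit by \<open>w\<close>.\<close>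
  proof (rule less.hyps[of _ _ "{p \<in> P. fst p \<noteq> w \<and> snd p \<noteq> w}"])
    show "card (V - insert w A - insert v B) < card (V - A - B)"
      using v assms(1) by (intro psubset_card_mono) auto
    fix p assume p: "p \<in> {p \<in> P. fst p \<noteq> w \<and> snd p \<noteq> w}"
    then show "fst p \<in> V - insert w A - insert v B \<and> snd p \<in> V - insert w A - insert v B
        \<and> fst p \<noteq> snd p"
      using less.prems(1)[of p] vp by blast
    fix q assume "q \<in> {p \<in> P. fst p \<noteq> w \<and> snd p \<noteq> w}" "p \<noteq> q"
    then show "{fst p, snd p} \<inter> {fst q, snd q} = {}"
      using p less.prems(2)[of p q] by blast
  next
    fix E assume "E \<in> \<E>"
    then show "E \<inter> insert w A \<noteq> {} \<or>
        (\<exists>p \<in> {p \<in> P. fst p \<noteq> w \<and> snd p \<noteq> w}. fst p \<in> E \<and> snd p \<in> E)"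
      using less.prems(3)[of E] by blast
  qed
  show ?case
  proof (cases "P = {}")
    case True
    then show ?thesis using less.prems(3) by (intro forces.reached) blast
  next
    case False
    show ?thesis
    proof (rule forces.adversary_move)
      show "V - A - B \<noteq> {}" using False less.prems(1) by blast
      fix v assume v: "v \<in> V - A - B"
      obtain w where "w \<in> V - A - insert v B"
        and "\<And>p. p \<in> P \<Longrightarrow> v = fst p \<Longrightarrow> w = snd p" "\<And>p. p \<in> P \<Longrightarrow> v = snd p \<Longrightarrow> w = fst p"
      proof (cases "\<exists>p \<in> P. v = fst p \<or> v = snd p")
        case True
        then obtain p w where p: "p \<in> P" "v = fst p \<or> v = snd p"
          and w: "v = fst p \<and> w = snd p \<or> v = snd p \<and> w = fst p" by blast
        have unique: "q = p" if "q \<in> P" "v = fst q \<or> v = snd q" for q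
          using less.prems(2)[of p q] p that by blast
        show ?thesis
        proof (rule that[of w])
          show "w \<in> V - A - insert v B" using w less.prems(1)[OF p(1)] by auto
          fix q assume "q \<in> P"
          then show "v = fst q \<Longrightarrow> w = snd q" "v = snd q \<Longrightarrow> w = fst q"
            using unique[of q] w less.prems(1)[OF p(1)] by metis+
        qed
      next
        \<comment> \<open>The adversary played outside all pairs, so one end of any pair is a safe
          reply.\<close>
        case none: False
        obtain p where "p \<in> P" using False by blast
        moreover from this have "fst p \<in> V - A - insert v B"
          using none less.prems(1)[of p] by auto
        ultimately show ?thesis using that none by blast
      qed
      then show "forces V ?goal True A (insert v B)"
        by (intro forces.own_move[of w] step v) auto
    qed
  qed
qed

section \<open>From forced wins to winning strategies\<close>

text \<open>Both goals are phrased in the player's own vertices and are monotone in them, which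
  \<open>forces_own_turn\<close> needs; \<open>wins_play\<close> judges Staller by Dominator's
  vertices instead.\<close>

fun player_goal :: "'a ugraph \<Rightarrow> player \<Rightarrow> 'a set \<Rightarrow> bool" where
  "player_goal G Dominator A \<longleftrightarrow> (\<forall>E \<in> closed_nbhd G ` verts G. E \<inter> A \<noteq> {})"
| "player_goal G Staller A \<longleftrightarrow> (\<exists>v \<in> verts G. closed_nbhd G v \<subseteq> A)"

lemma mono_player_goal:
  fixes G :: "'a ugraph"
  shows "mono (player_goal G p)"
proof (rule monoI, rule le_boolI)
  fix A B :: "'a set"
  assume "A \<subseteq> B" "player_goal G p A"
  then show "player_goal G p B"
    by (cases p) (simp, blast)+
qed

lemma mem_claimed: "x \<in> claimed first p h \<longleftrightarrow> (\<exists>i < length h. h ! i = x \<and> mover first i = p)"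
  unfolding claimed_def by blast

lemma claimed_Nil [simp]: "claimed first p [] = {}"
  by (simp add: claimed_def)

lemma claimed_snoc:
  "claimed first p (h @ [v]) =
    (if mover first (length h) = p then insert v (claimed first p h) else claimed first p h)"
proof (rule set_eqI)
  fix x
  have "x \<in> claimed first p (h @ [v]) \<longleftrightarrow>
      (mover first (length h) = p \<and> v = x) \<or> (\<exists>i < length h. h ! i = x \<and> mover first i = p)"
    by (simp add: mem_claimed Ex_less_Suc nth_append cong: conj_cong) blast
  then show "x \<in> claimed first p (h @ [v]) \<longleftrightarrow>
      x \<in> (if mover first (length h) = p then insert v (claimed first p h) else claimed first p h)"
    by (auto simp: mem_claimed)
qed

lemma opponent_neq [simp]: "opponent p \<noteq> p" "p \<noteq> opponent p"
  by (cases p; simp)+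

lemma player_cases: "q = p \<or> q = opponent p"
  by (cases p; cases q) auto

lemma claimed_Un: "claimed first p h \<union> claimed first (opponent p) h = set h"
proof (rule set_eqI)
  fix x
  show "x \<in> claimed first p h \<union> claimed first (opponent p) h \<longleftrightarrow> x \<in> set h"
    unfolding Un_iff mem_claimed in_set_conv_nth using player_cases[of _ p] by blast
qed

lemma claimed_disjoint:
  assumes "distinct h"
  shows "claimed first p h \<inter> claimed first (opponent p) h = {}"
proof -
  have False if "x \<in> claimed first p h" and x: "x \<in> claimed first (opponent p) h" for x
  proof -
    obtain i where i: "i < length h" "h ! i = x" "mover first i = p"
      using \<open>x \<in> claimed first p h\<close> unfolding mem_claimed by blast
    obtain j where "j < length h" "h ! j = x" "mover first j = opponent p"
      using x unfolding mem_claimed by blast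
    then show False using i assms nth_eq_iff_index_eq[of h i j] by simp
  qed
  then show ?thesis by blast
qed

text \<open>For Staller, disjointness of the two claimed sets means that Dominator misses a closed
  neighbourhood she owns.\<close>

lemma wins_play_if_player_goal:
  assumes "complete_play G h" and "player_goal G p (claimed first p h)"
  shows "wins_play G first p h"
proof (cases p)
  case Dominator
  then show ?thesis
    using assms claimed_Un[of first p h]
    by (auto simp: dominating_set_def complete_play_def)
next
  case Staller
  then show ?thesis
    using assms claimed_disjoint[of h first p]
    unfolding dominating_set_def complete_play_def Staller wins_play.simps player_goal.simps
      opponent.simps by blast
qed

lemma mover_Suc: "mover first (Suc i) = opponent (mover first i)"
  by (cases first) (auto simp: mover_def)

text \<open>The strategy chooses any move that keeps the position forced. This is invariant along
  plays that follow it, and a forced position on a full board has its goal reached.\<close>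

lemma has_winning_strategy_if_forces:
  fixes G :: "'a ugraph"
  assumes "forces (verts G) (player_goal G p) (first = p) {} {}"
  shows "has_winning_strategy G first p"
proof -
  define own adv :: "'a list \<Rightarrow> 'a set"
    where "own = claimed first p" and "adv = claimed first (opponent p)"
  define \<sigma> where "\<sigma> h = (SOME v. v \<in> verts G - own h - adv h \<and>
      forces (verts G) (player_goal G p) False (insert v (own h)) (adv h))" for h
  have free: "verts G - own h - adv h = verts G - set h" for h
    using claimed_Un[of first p h] by (auto simp: own_def adv_def)
  have \<sigma>: "\<sigma> h \<in> verts G - set h"
    "forces (verts G) (player_goal G p) False (insert (\<sigma> h) (own h)) (adv h)"
    if "forces (verts G) (player_goal G p) True (own h) (adv h)" "verts G - set h \<noteq> {}" for h
  proof -
    have "\<exists>v. v \<in> verts G - own h - adv h \<and>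
      forces (verts G) (player_goal G p) False (insert v (own h)) (adv h)"
      using forces_own_turn[OF that(1) mono_player_goal] that(2) free by metis
    then have "\<sigma> h \<in> verts G - own h - adv h \<and>
      forces (verts G) (player_goal G p) False (insert (\<sigma> h) (own h)) (adv h)"
      unfolding \<sigma>_def by (rule someI_ex)
    then show "\<sigma> h \<in> verts G - set h"
      "forces (verts G) (player_goal G p) False (insert (\<sigma> h) (own h)) (adv h)"
      using free by simp_all
  qed
  have inv: "forces (verts G) (player_goal G p) (mover first (length h) = p) (own h) (adv h)"
    if "partial_play G h" "follows first p \<sigma> h" for h
    using that
  proof (induction h rule: rev_induct)
    case Nil
    then show ?case using assms by (simp add: own_def adv_def mover_def)
  next
    case (snoc v h)
    have v: "v \<in> verts G - set h" and "partial_play G h"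
      using snoc.prems(1) by (auto simp: partial_play_def)
    moreover have fol: "follows first p \<sigma> h" and last: "mover first (length h) = p \<longrightarrow> v = \<sigma> h"
      using snoc.prems(2) by (auto simp: follows_def nth_append less_Suc_eq all_conj_distrib)
    ultimately have IH:
      "forces (verts G) (player_goal G p) (mover first (length h) = p) (own h) (adv h)"
      using snoc.IH by blast
    show ?case
    proof (cases "mover first (length h) = p")
      case True
      then show ?thesis
        using IH v \<sigma>(2)[of h] last by (auto simp: own_def adv_def claimed_snoc mover_Suc)
    next
      case False
      then have "mover first (length h) = opponent p" using player_cases by blast
      moreover have "opponent (opponent p) = p" by (cases p) auto
      moreover have "forces (verts G) (player_goal G p) True (own h) (insert v (adv h))"
        by (rule forces_adversary_turn) (use IH False v free in simp_all)
      ultimately show ?thesis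
        by (simp add: own_def adv_def claimed_snoc mover_Suc)
    qed
  qed
  have "winning_strategy G first p \<sigma>"
    unfolding winning_strategy_def
  proof (intro conjI allI impI; elim conjE)
    fix h
    assume "partial_play G h" "set h \<noteq> verts G" "follows first p \<sigma> h"
      "mover first (length h) = p"
    moreover from this have "verts G - set h \<noteq> {}" by (auto simp: partial_play_def)
    ultimately show "\<sigma> h \<in> verts G - set h" using \<sigma>(1)[of h] inv[of h] by simp
  next
    fix h
    assume h: "complete_play G h" "follows first p \<sigma> h"
    then have "forces (verts G) (player_goal G p) (mover first (length h) = p) (own h) (adv h)"
      by (intro inv) (auto simp: partial_play_def complete_play_def)
    moreover have "verts G - own h - adv h = {}"
      using h(1) by (simp add: free complete_play_def)
    ultimately have "player_goal G p (own h)" by (rule forces_full_board)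
    then show "wins_play G first p h"
      using h(1) by (auto simp: own_def intro: wins_play_if_player_goal)
  qed
  then show ?thesis unfolding has_winning_strategy_def by blast
qed

section \<open>Products of two stars\<close>

lemma verts_star_prod: "verts (star m \<box> star n) = {0..m} \<times> {0..n}"
  by (simp add: cart_prod_def star_def)

lemma closed_nbhd_star_prod:
  assumes "i \<le> m" and "j \<le> n"
  shows "closed_nbhd (star m \<box> star n) (i, j) =
    {i} \<times> (if j = 0 then {0..n} else {0, j}) \<union> (if i = 0 then {0..m} else {0, i}) \<times> {j}"
  using assms by (auto simp: closed_nbhd_def cart_prod_def star_def)

abbreviation dominator_forces :: "nat \<Rightarrow> nat \<Rightarrow> bool \<Rightarrow> (nat \<times> nat) set \<Rightarrow> (nat \<times> nat) set \<Rightarrow> bool" where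
  "dominator_forces m n \<equiv>
    forces ({0..m} \<times> {0..n}) (player_goal (star m \<box> star n) Dominator)"

abbreviation staller_forces :: "nat \<Rightarrow> nat \<Rightarrow> bool \<Rightarrow> (nat \<times> nat) set \<Rightarrow> (nat \<times> nat) set \<Rightarrow> bool" where
  "staller_forces m n \<equiv>
    forces ({0..m} \<times> {0..n}) (player_goal (star m \<box> star n) Staller)"

section \<open>Staller's forced wins\<close>

lemma staller_goal_swap:
  assumes "player_goal (star m \<box> star n) Staller A"
  shows "player_goal (star n \<box> star m) Staller (prod.swap ` A)"
proof -
  obtain i j where "i \<le> m" "j \<le> n" "closed_nbhd (star m \<box> star n) (i, j) \<subseteq> A"
    using assms by (auto simp: verts_star_prod)
  then have "closed_nbhd (star n \<box> star m) (j, i) \<subseteq> prod.swap ` A"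
    by (auto simp: closed_nbhd_star_prod split: if_splits)
  with \<open>i \<le> m\<close> \<open>j \<le> n\<close> show ?thesis
    unfolding player_goal.simps verts_star_prod by (intro bexI[of _ "(j, i)"]) auto
qed

lemma staller_forces_swap:
  assumes "staller_forces m n t A B"
  shows "staller_forces n m t (prod.swap ` A) (prod.swap ` B)"
  using forces_image[OF assms, of prod.swap "player_goal (star n \<box> star m) Staller"] staller_goal_swap
  by (simp add: product_swap)

text \<open>A vertex outside row \<open>0\<close> and column \<open>0\<close> has only the
  neighbours \<open>(i, 0)\<close> and \<open>(0, j)\<close>. These small closed neighbourhoods
  supply every threat that Dominator is made to answer.\<close>

lemma staller_goal_inner:
  assumes "i \<in> {1..m}" "j \<in> {1..n}" and "(i, 0) \<in> A" "(0, j) \<in> A" "(i, j) \<in> A"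
  shows "player_goal (star m \<box> star n) Staller A"
proof -
  have "closed_nbhd (star m \<box> star n) (i, j) \<subseteq> A"
    using assms by (auto simp: closed_nbhd_star_prod)
  then show ?thesis using assms(1,2) by (force simp: verts_star_prod)
qed

text \<open>Claiming \<open>(i, k)\<close> forces the answer \<open>(0, k)\<close>, so Staller collects the whole row \<open>i\<close> with
  tempo and then completes the closed neighbourhood of \<open>(i, 0)\<close> by claiming \<open>(0, 0)\<close>.\<close>

lemma staller_forces_row:
  assumes "finite K" and "K \<subseteq> {1..n}" and "i \<in> {1..m}" and "(i, 0) \<in> A" and "(0, 0) \<notin> A \<union> B"
    and "\<And>j. j \<in> {1..n} - K \<Longrightarrow> (i, j) \<in> A"
    and "\<And>k. k \<in> K \<Longrightarrow> (i, k) \<notin> A \<union> B \<and> (0, k) \<notin> A \<union> B"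
  shows "staller_forces m n True A B"
  using assms
\<comment> \<open>\<open>K\<close> holds the columns still open in row \<open>i\<close>; each
  exchange puts \<open>(i, k)\<close> into \<open>A\<close> and \<open>(0, k)\<close> into
  \<open>B\<close>.\<close>
proof (induction K arbitrary: A B rule: finite_induct)
  case empty
  show ?case
  proof (rule forces_winning_move)
    show "(0, 0) \<in> {0..m} \<times> {0..n} - A - B" using empty by auto
    have "(i, j) \<in> A" if "j \<le> n" for j
      using empty that by (cases "j = 0") auto
    then have "closed_nbhd (star m \<box> star n) (i, 0) \<subseteq> insert (0, 0) A"
      using empty by (auto simp: closed_nbhd_star_prod)
    then show "player_goal (star m \<box> star n) Staller (insert (0, 0) A)"
      using empty by (force simp: verts_star_prod)
  qed
next
  case (insert k K)
  have k: "k \<in> {1..n}" "(i, k) \<notin> A \<union> B" "(0, k) \<notin> A \<union> B"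
    using insert.prems(1) insert.prems(6)[of k] by auto
  show ?case
  proof (rule forces.own_move)
    show "(i, k) \<in> {0..m} \<times> {0..n} - A - B" using insert.prems k by auto
    show "staller_forces m n False (insert (i, k) A) B"
    proof (rule forces_threat)
      show "(0, k) \<in> {0..m} \<times> {0..n} - insert (i, k) A - B"
        using insert.prems k by auto
      show "player_goal (star m \<box> star n) Staller (insert (0, k) (insert (i, k) A))"
        by (rule staller_goal_inner[of i m k n]) (use insert.prems(2,3) k in auto)
      show "staller_forces m n True (insert (i, k) A) (insert (0, k) B)"
        by (rule insert.IH) (use insert.prems insert.hyps k in auto)
    qed
  qed
qed

text \<open>Claiming \<open>(0, j)\<close> threatens \<open>(i, j)\<close> and
  \<open>(i', j)\<close> at once, and Dominator can block only one of them.\<close>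

lemma staller_forces_column:
  assumes "i \<in> {1..m}" "i' \<in> {1..m}" "i \<noteq> i'" "j \<in> {1..n}" "(i, 0) \<in> A" "(i', 0) \<in> A"
    and "(0, j) \<notin> A \<union> B" "(i, j) \<notin> A \<union> B" "(i', j) \<notin> A \<union> B"
  shows "staller_forces m n True A B"
proof (rule forces.own_move)
  show "(0, j) \<in> {0..m} \<times> {0..n} - A - B" using assms by auto
  show "staller_forces m n False (insert (0, j) A) B"
  proof (rule forces_threat)
    show "(i, j) \<in> {0..m} \<times> {0..n} - insert (0, j) A - B" using assms by auto
    show "player_goal (star m \<box> star n) Staller (insert (i, j) (insert (0, j) A))"
      by (rule staller_goal_inner[of i m j n]) (use assms in auto)
    show "staller_forces m n True (insert (0, j) A) (insert (i, j) B)"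
    proof (rule forces_winning_move)
      show "(i', j) \<in> {0..m} \<times> {0..n} - insert (0, j) A - insert (i, j) B" using assms by auto
      show "player_goal (star m \<box> star n) Staller (insert (i', j) (insert (0, j) A))"
        by (rule staller_goal_inner[of i' m j n]) (use assms in auto)
    qed
  qed
qed

text \<open>Apart from \<open>z\<close>, Dominator's vertices do not interfere with the columns \<open>j \<ge> 1\<close> in the rows
  \<open>0\<close>, \<open>i\<close>, \<open>i'\<close>. Of three columns, \<open>z\<close> and Dominator's next move spoil at most two.\<close>

lemma staller_forces_second_row:
  assumes "n \<ge> 3" "i \<in> {1..m}" "i' \<in> {1..m}" "i \<noteq> i'" and "(i', 0) \<notin> B"
    and "\<And>v. v \<in> B \<Longrightarrow> v = z \<or> snd v = 0 \<or> fst v \<notin> {0, i, i'}"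
  shows "staller_forces m n True {(i, 0)} B"
proof (rule forces.own_move)
  show "(i', 0) \<in> {0..m} \<times> {0..n} - {(i, 0)} - B" using assms(2-5) by auto
  have column: "\<exists>j \<in> {1..n}. j \<noteq> snd z \<and> j \<noteq> snd w" for w :: "nat \<times> nat"
  proof -
    have "\<exists>j \<in> {1, 2, 3}. j \<noteq> snd z \<and> j \<noteq> snd w" by simp presburger
    moreover have "{1, 2, 3} \<subseteq> {1..n}" using assms(1) by auto
    ultimately show ?thesis by blast
  qed
  show "staller_forces m n False {(i', 0), (i, 0)} B"
  proof (rule forces.adversary_move)
    obtain j where "j \<in> {1..n}" "j \<noteq> snd z" using column by blast
    then have "(0, j) \<in> {0..m} \<times> {0..n} - {(i', 0), (i, 0)} - B"
      using assms(6)[of "(0, j)"] by auto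
    then show "{0..m} \<times> {0..n} - {(i', 0), (i, 0)} - B \<noteq> {}" by blast
  next
    fix w :: "nat \<times> nat"
    obtain j where j: "j \<in> {1..n}" "j \<noteq> snd z" "j \<noteq> snd w" using column by blast
    have free: "(k, j) \<notin> insert w B" if "k \<in> {0, i, i'}" for k
      using assms(6)[of "(k, j)"] j that by auto
    show "staller_forces m n True {(i', 0), (i, 0)} (insert w B)"
      by (rule staller_forces_column[of i m i' j n])
        (use assms(2-4) j(1) free[of 0] free[of i] free[of i'] in simp_all)
  qed
qed

text \<open>After \<open>(i, 0)\<close>, the answer \<open>(i', 0)\<close> leaves rows
  \<open>0\<close> and \<open>i\<close> open for the forcing sequence along row \<open>i\<close>;
  any other answer leaves \<open>(i', 0)\<close> to Staller and becomes the exceptional vertex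
  \<open>z\<close>.\<close>

lemma staller_forces_two_rows:
  assumes "n \<ge> 3" "i \<in> {1..m}" "i' \<in> {1..m}" "i \<noteq> i'"
    and B: "\<And>v. v \<in> B \<Longrightarrow> fst v \<notin> {0, i, i'}"
  shows "staller_forces m n True {} B"
proof (rule forces.own_move)
  have free: "(k, l) \<notin> B" if "k \<in> {0, i, i'}" for k l
    using B that by force
  show "(i, 0) \<in> {0..m} \<times> {0..n} - {} - B" using assms(2) free by auto
  show "staller_forces m n False {(i, 0)} B"
  proof (rule forces.adversary_move)
    have "(0, 0) \<in> {0..m} \<times> {0..n} - {(i, 0)} - B" using assms(2) free by auto
    then show "{0..m} \<times> {0..n} - {(i, 0)} - B \<noteq> {}" by blast
  next
    fix z
    show "staller_forces m n True {(i, 0)} (insert z B)"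
    proof (cases "z = (i', 0)")
      case True
      show ?thesis
        by (rule staller_forces_row[of "{1..n}" n i]) (use assms(2-4) free True in auto)
    next
      case False
      show ?thesis
        by (rule staller_forces_second_row[where i' = i' and z = z])
          (use assms(1-4) B free False in auto)
    qed
  qed
qed

text \<open>With \<open>(0, 0)\<close> lost, the sequence along a row cannot be completed, so
  \<open>(1, 0)\<close> needs two possible partners, \<open>(2, 0)\<close> and
  \<open>(3, 0)\<close>; Dominator's answer blocks at most one.\<close>

lemma staller_forces_after_centre:
  assumes "m \<ge> 3" "n \<ge> 3"
  shows "staller_forces m n True {} {(0, 0)}"
proof (rule forces.own_move)
  show "(1, 0) \<in> {0..m} \<times> {0..n} - {} - {(0, 0)}" using assms by auto
  show "staller_forces m n False {(1, 0)} {(0, 0)}"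
  proof (rule forces.adversary_move)
    have "(0, 1) \<in> {0..m} \<times> {0..n} - {(1, 0)} - {(0, 0)}" using assms by auto
    then show "{0..m} \<times> {0..n} - {(1, 0)} - {(0, 0)} \<noteq> {}" by blast
  next
    fix z
    show "staller_forces m n True {(1, 0)} {z, (0, 0)}"
      by (rule staller_forces_second_row[where i' = "if z = (2, 0) then 3 else 2" and z = z])
        (use assms in auto)
  qed
qed

lemma staller_forces_second:
  assumes "m \<ge> 3" "n \<ge> 3"
  shows "staller_forces m n False {} {}"
proof (rule forces.adversary_move)
  show "{0..m} \<times> {0..n} - {} - {} \<noteq> {}" by simp
  fix v assume v: "v \<in> {0..m} \<times> {0..n} - {} - {}"
  \<comment> \<open>Of at least three rows besides row \<open>0\<close>, two avoid Dominator's
    vertex, which itself lies outside row \<open>0\<close>.\<close>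
  have rows: "staller_forces k l True {} {(i, j)}" if "k \<ge> 3" "l \<ge> 3" "i \<noteq> 0" for i j k l
  proof -
    have "\<exists>r s. r \<in> {1..k} \<and> s \<in> {1..k} \<and> r \<noteq> s \<and> r \<noteq> i \<and> s \<noteq> i"
    proof -
      consider "i = 1" | "i = 2" | "i \<noteq> 1" "i \<noteq> 2" by blast
      then show ?thesis
        using that(1)
        by cases (rule exI[of _ 2] exI[of _ 1], rule exI[of _ 3] exI[of _ 2], simp)+
    qed
    then obtain r s where "r \<in> {1..k}" "s \<in> {1..k}" "r \<noteq> s" "r \<noteq> i" "s \<noteq> i" by blast
    then show ?thesis
      using that by (intro staller_forces_two_rows[of l r k s]) auto
  qed
  obtain i j where ij: "v = (i, j)" by (cases v)
  consider "i \<noteq> 0" | "i = 0" "j \<noteq> 0" | "i = 0" "j = 0" by blast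
  then show "staller_forces m n True {} {v}"
  proof cases
    case 1
    then show ?thesis using rows assms ij by simp
  next
    case 2
    \<comment> \<open>Exchanging the factors moves Dominator's vertex out of row \<open>0\<close>,
      so \<open>rows\<close> applies with the sizes swapped.\<close>
    then have "staller_forces n m True {} {(j, i)}" using rows assms by simp
    from staller_forces_swap[OF this] show ?thesis using ij by simp
  next
    case 3
    then show ?thesis using staller_forces_after_centre assms ij by simp
  qed
qed

section \<open>Dominator's pairing strategies\<close>

text \<open>\<open>near\<close> describes the closed neighbourhoods of the product without mentioning its bounds.\<close>

fun near :: "nat \<times> nat \<Rightarrow> nat \<times> nat \<Rightarrow> bool" where
  "near (a, b) (i, j) \<longleftrightarrow> a = i \<and> (b = j \<or> b = 0 \<or> j = 0) \<or> b = j \<and> (a = 0 \<or> i = 0)"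

lemma closed_nbhd_near:
  assumes "v \<in> {0..m} \<times> {0..n}" and "u \<in> {0..m} \<times> {0..n}"
  shows "u \<in> closed_nbhd (star m \<box> star n) v \<longleftrightarrow> near u v"
  using assms by (cases u; cases v) (auto simp: closed_nbhd_star_prod)

lemma dominator_forces_pairing:
  assumes A: "A \<subseteq> {0..m} \<times> {0..n}"
    and free: "\<And>p. p \<in> P \<Longrightarrow> fst p \<in> {0..m} \<times> {0..n} - A - B \<and> snd p \<in> {0..m} \<times> {0..n} - A - B
      \<and> fst p \<noteq> snd p"
    and disjoint: "\<And>p q. p \<in> P \<Longrightarrow> q \<in> P \<Longrightarrow> p \<noteq> q \<Longrightarrow> {fst p, snd p} \<inter> {fst q, snd q} = {}"
    and covers: "\<And>i j. i \<le> m \<Longrightarrow> j \<le> n \<Longrightarrow> (\<exists>u \<in> A. near u (i, j)) \<or>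
      (\<exists>p \<in> P. near (fst p) (i, j) \<and> near (snd p) (i, j))"
  shows "dominator_forces m n False A B"
proof -
  let ?\<E> = "closed_nbhd (star m \<box> star n) ` ({0..m} \<times> {0..n})"
  have "player_goal (star m \<box> star n) Dominator = (\<lambda>X. \<forall>E \<in> ?\<E>. E \<inter> X \<noteq> {})"
    by (rule ext) (simp only: player_goal.simps verts_star_prod)
  moreover have "forces ({0..m} \<times> {0..n}) (\<lambda>X. \<forall>E \<in> ?\<E>. E \<inter> X \<noteq> {}) False A B"
  proof (rule forces_pairing[of _ P])
    fix E assume "E \<in> ?\<E>"
    then obtain i j where ij: "i \<le> m" "j \<le> n" "E = closed_nbhd (star m \<box> star n) (i, j)"
      by auto
    then have near: "u \<in> E \<longleftrightarrow> near u (i, j)" if "u \<in> {0..m} \<times> {0..n}" for u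
      using that closed_nbhd_near[of "(i, j)" m n u] by simp
    from covers[OF ij(1,2)] show "E \<inter> A \<noteq> {} \<or> (\<exists>p \<in> P. fst p \<in> E \<and> snd p \<in> E)"
    proof (elim disjE bexE conjE)
      fix u assume "u \<in> A" "near u (i, j)"
      then show ?thesis using near[of u] A by blast
    next
      fix p assume "p \<in> P" "near (fst p) (i, j)" "near (snd p) (i, j)"
      then show ?thesis using near[of "fst p"] near[of "snd p"] free[of p] by blast
    qed
  qed (use free disjoint in simp_all)
  ultimately show ?thesis by simp
qed

lemma le_2_cases: "(i::nat) \<le> 2 \<longleftrightarrow> i = 0 \<or> i = 1 \<or> i = 2"
  by auto

text \<open>In list form the hypotheses can be checked by simplification: one
  \<open>distinct\<close> condition says both that the pairs are unclaimed and that they are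
  disjoint.\<close>

lemma dominator_forces_2_2_pairing:
  assumes distinct: "distinct (A @ B @ map fst ps @ map snd ps)"
    and board: "set (A @ map fst ps @ map snd ps) \<subseteq> {0..2} \<times> {0..2}"
    and covers: "\<forall>i \<in> {0, 1, 2}. \<forall>j \<in> {0, 1, 2}. (\<exists>u \<in> set A. near u (i, j)) \<or>
      (\<exists>p \<in> set ps. near (fst p) (i, j) \<and> near (snd p) (i, j))"
  shows "dominator_forces 2 2 False (set A) (set B)"
proof (rule dominator_forces_pairing[of _ _ _ "set ps"])
  show "set A \<subseteq> {0..2} \<times> {0..2}" using board by simp
next
  have disjoint: "fst ` set ps \<inter> snd ` set ps = {}"
    using distinct by simp
  have neq: "fst p \<noteq> snd q" if "p \<in> set ps" "q \<in> set ps" for p q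
    using disjoint that by (metis IntI empty_iff imageI)
  have sets: "set A \<inter> fst ` set ps = {}" "set A \<inter> snd ` set ps = {}"
    "set B \<inter> fst ` set ps = {}" "set B \<inter> snd ` set ps = {}"
    "fst ` set ps \<subseteq> {0..2} \<times> {0..2}" "snd ` set ps \<subseteq> {0..2} \<times> {0..2}"
    using distinct board by (simp_all add: Int_Un_distrib)
  have free: "x \<in> {0..2} \<times> {0..2} - set A - set B" if "x \<in> fst ` set ps \<or> x \<in> snd ` set ps" for x
  proof -
    have "x \<notin> set A" "x \<notin> set B" using that sets(1-4) by blast+
    moreover have "x \<in> {0..2} \<times> {0..2}" using that sets(5,6) by (elim disjE) (simp_all only: subset_iff)
    ultimately show ?thesis by simp
  qed
  fix p assume p: "p \<in> set ps"
  then have "fst p \<in> fst ` set ps" "snd p \<in> snd ` set ps" by simp_all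
  then show "fst p \<in> {0..2} \<times> {0..2} - set A - set B \<and> snd p \<in> {0..2} \<times> {0..2} - set A - set B
      \<and> fst p \<noteq> snd p"
    using neq[OF p p] free by metis
  fix q assume q: "q \<in> set ps" "p \<noteq> q"
  have "inj_on fst (set ps)" "inj_on snd (set ps)"
    using distinct by (simp_all add: distinct_map)
  then have "fst p \<noteq> fst q" "snd p \<noteq> snd q" using p q inj_on_contraD by metis+
  then show "{fst p, snd p} \<inter> {fst q, snd q} = {}"
    using neq[OF p q(1)] neq[OF q(1) p] by auto
next
  fix i j :: nat assume "i \<le> 2" "j \<le> 2"
  then have "i \<in> {0, 1, 2}" "j \<in> {0, 1, 2}" using le_2_cases by simp_all
  then show "(\<exists>u \<in> set A. near u (i, j)) \<or>
      (\<exists>p \<in> set ps. near (fst p) (i, j) \<and> near (snd p) (i, j))"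
    using covers by blast
qed

lemma dominator_forces_2_2_first: "dominator_forces 2 2 True {} {}"
proof (rule forces.own_move[of "(0, 0)"])
  \<comment> \<open>\<open>(0, 0)\<close> dominates row \<open>0\<close> and column
    \<open>0\<close>; each of the other four vertices is paired with one of its two neighbours,
    chosen so that none is used twice.\<close>
  show "dominator_forces 2 2 False {(0, 0)} {}"
    using dominator_forces_2_2_pairing[of "[(0, 0)]" "[]"
        "[((1, 0), (1, 1)), ((0, 1), (2, 1)), ((2, 0), (2, 2)), ((0, 2), (1, 2))]"]
    by simp
qed simp

text \<open>Each reply has exactly one coordinate \<open>0\<close> and so dominates four vertices;
  three pairs guard the closed neighbourhoods of the other five.\<close>

lemma dominator_forces_2_2_second: "dominator_forces 2 2 False {} {}"
proof (rule forces.adversary_move)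
  fix v :: "nat \<times> nat" assume v: "v \<in> {0..2} \<times> {0..2} - {} - {}"
  have reply: "dominator_forces 2 2 True {} {v}"
    if "dominator_forces 2 2 False (set [r]) (set [v])" "r \<in> {0..2} \<times> {0..2} - {} - {v}" for r
    using that(1) by (intro forces.own_move[OF that(2)]) simp
  obtain i j where ij: "v = (i, j)" "i = 0 \<or> i \<in> {1, 2}" "j = 0 \<or> j \<in> {1, 2}"
    using v le_2_cases by (cases v) simp
  \<comment> \<open>\<open>3 - i\<close> and \<open>3 - j\<close> are the other elements of \<open>{1, 2}\<close>.\<close>
  consider "i \<in> {1, 2}" "j = 0" | "i = 0" "j \<in> {1, 2}" | "i = 0" "j = 0" | "i \<in> {1, 2}" "j \<in> {1, 2}"
    using ij by blast
  then show "dominator_forces 2 2 True {} {v}"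
  proof cases
    case 1
    have "dominator_forces 2 2 False (set [(0, 1)]) (set [v])"
      by (rule dominator_forces_2_2_pairing[of _ _
            "[((i, 2), (0, 2)), ((0, 0), (i, 1)), ((3 - i, 0), (3 - i, 2))]"])
        (use 1 ij(1) in auto)
    moreover have "(0, 1) \<in> {0..2} \<times> {0..2} - {} - {v}" using 1 ij by auto
    ultimately show ?thesis by (rule reply)
  next
    case 2
    have "dominator_forces 2 2 False (set [(1, 0)]) (set [v])"
      by (rule dominator_forces_2_2_pairing[of _ _
            "[((2, j), (2, 0)), ((0, 0), (1, j)), ((0, 3 - j), (2, 3 - j))]"])
        (use 2 ij(1) in auto)
    moreover have "(1, 0) \<in> {0..2} \<times> {0..2} - {} - {v}" using 2 ij by auto
    ultimately show ?thesis by (rule reply)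
  next
    case 3
    have "dominator_forces 2 2 False (set [(1, 0)]) (set [v])"
      by (rule dominator_forces_2_2_pairing[of _ _
            "[((2, 0), (2, 2)), ((0, 1), (2, 1)), ((0, 2), (1, 2))]"])
        (use 3 ij(1) in auto)
    moreover have "(1, 0) \<in> {0..2} \<times> {0..2} - {} - {v}" using 3 ij by auto
    ultimately show ?thesis by (rule reply)
  next
    case 4
    have "dominator_forces 2 2 False (set [(i, 0)]) (set [v])"
      by (rule dominator_forces_2_2_pairing[of _ _
            "[((0, j), (3 - i, j)), ((3 - i, 0), (3 - i, 3 - j)), ((0, 3 - j), (i, 3 - j))]"])
        (insert 4 ij(1); elim insertE emptyE; simp)+
    moreover have "(i, 0) \<in> {0..2} \<times> {0..2} - {} - {v}" using 4 ij by auto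
    ultimately show ?thesis by (rule reply)
  qed
qed simp

text \<open>\<open>(3 - k, 0)\<close> and \<open>(0, 0)\<close> dominate everything except the
  vertices \<open>(k, l)\<close> with \<open>l \<ge> 1\<close>, and each of these is guarded by
  pairing it with \<open>(0, l)\<close>.\<close>

lemma dominator_forces_other_row:
  assumes "k \<in> {1, 2}" and "\<And>l. l \<in> {1..n} \<Longrightarrow> (k, l) \<notin> B \<and> (0, l) \<notin> B"
  shows "dominator_forces 2 n False {(3 - k, 0), (0, 0)} B"
proof (rule dominator_forces_pairing[of _ _ _ "(\<lambda>l. ((k, l), (0, l))) ` {1..n}"])
  fix i j :: nat assume ij: "i \<le> 2" "j \<le> n"
  have "i = 3 - k \<or> i = 0 \<or> i = k" using assms(1) ij(1) by auto
  moreover have "j = 0 \<or> j \<in> {1..n}" using ij(2) by auto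
  ultimately consider "i = 3 - k" | "i = 0 \<or> j = 0" | "i = k" "j \<in> {1..n}" by blast
  then show "(\<exists>u \<in> {(3 - k, 0), (0, 0)}. near u (i, j)) \<or>
      (\<exists>p \<in> (\<lambda>l. ((k, l), (0, l))) ` {1..n}. near (fst p) (i, j) \<and> near (snd p) (i, j))"
    by cases auto
next
  fix p :: "(nat \<times> nat) \<times> nat \<times> nat" assume "p \<in> (\<lambda>l. ((k, l), (0, l))) ` {1..n}"
  then obtain l where l: "l \<in> {1..n}" "p = ((k, l), (0, l))" by blast
  have "k \<noteq> 0" "k \<le> 2" using assms(1) by auto
  then show "fst p \<in> {0..2} \<times> {0..n} - {(3 - k, 0), (0, 0)} - B \<and>
      snd p \<in> {0..2} \<times> {0..n} - {(3 - k, 0), (0, 0)} - B \<and> fst p \<noteq> snd p"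
    using l assms(2)[of l] by simp
qed (use assms(1) in auto)

text \<open>Owning the centre, Dominator adds \<open>(1, 0)\<close> or \<open>(2, 0)\<close>, after
  which only one row is left to guard column by column.\<close>

lemma dominator_forces_2_first: "dominator_forces 2 n True {} {}"
proof (rule forces.own_move[of "(0, 0)"])
  show "dominator_forces 2 n False {(0, 0)} {}"
  proof (rule forces.adversary_move)
    have "(1, 0) \<in> {0..2::nat} \<times> {0..n} - {(0, 0)} - {}" by simp
    then show "{0..2::nat} \<times> {0..n} - {(0, 0)} - {} \<noteq> {}" by blast
  next
    fix v :: "nat \<times> nat" assume v: "v \<in> {0..2} \<times> {0..n} - {(0, 0)} - {}"
    have reply: "dominator_forces 2 n True {(0, 0)} {v}"
      if "r \<in> {0..2} \<times> {0..n} - {(0, 0)} - {v}" "dominator_forces 2 n False {r, (0, 0)} {v}" for r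
      using that by (rule forces.own_move)
    obtain i j where ij: "v = (i, j)" by (cases v)
    have "i = 0 \<or> i \<in> {1, 2}" "j = 0 \<or> j \<in> {1..n}" "i \<noteq> 0 \<or> j \<noteq> 0"
      using v ij le_2_cases[of i] by auto
    then consider "i \<in> {1, 2}" "j = 0" | "i \<in> {1, 2}" "j \<in> {1..n}" | "i = 0" "j \<in> {1..n}"
      by blast
    then show "dominator_forces 2 n True {(0, 0)} {v}"
    proof cases
      case 1
      have "dominator_forces 2 n False {(3 - i, 0), (0, 0)} {v}"
        by (rule dominator_forces_other_row) (use 1 ij in auto)
      moreover have "(3 - i, 0) \<in> {0..2} \<times> {0..n} - {(0, 0)} - {v}" using 1 ij by auto
      ultimately show ?thesis using reply by blast
    next
      case 2
      \<comment> \<open>The row left to guard is \<open>3 - i\<close>, so the reply is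
        \<open>(i, 0)\<close>, in the row of Staller's vertex.\<close>
      have "dominator_forces 2 n False {(3 - (3 - i), 0), (0, 0)} {v}"
        by (rule dominator_forces_other_row) (use 2 ij in auto)
      moreover have "3 - (3 - i) = i" using 2 by auto
      moreover have "(i, 0) \<in> {0..2} \<times> {0..n} - {(0, 0)} - {v}" using 2 ij by auto
      ultimately show ?thesis using reply by metis
    next
      case 3
      \<comment> \<open>Staller holds \<open>(0, j)\<close>, so \<open>(2, j)\<close> is paired with
        its other neighbour \<open>(2, 0)\<close>.\<close>
      let ?P = "insert ((2, j), (2, 0)) ((\<lambda>l. ((2, l), (0, l))) ` ({1..n} - {j}))"
      have "dominator_forces 2 n False {(1, 0), (0, 0)} {v}"
      proof (rule dominator_forces_pairing[of _ _ _ ?P])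
        fix k l :: nat assume kl: "k \<le> 2" "l \<le> n"
        have "k = 1 \<or> k = 0 \<or> k = 2" using kl(1) by auto
        moreover have "l = 0 \<or> l = j \<or> l \<in> {1..n} - {j}" using kl(2) by auto
        ultimately consider "k = 1" | "k = 0 \<or> l = 0" | "k = 2" "l = j"
          | "k = 2" "l \<in> {1..n} - {j}" by blast
        then show "(\<exists>u \<in> {(1, 0), (0, 0)}. near u (k, l)) \<or>
            (\<exists>p \<in> ?P. near (fst p) (k, l) \<and> near (snd p) (k, l))"
          by cases auto
      next
        fix p :: "(nat \<times> nat) \<times> nat \<times> nat" assume "p \<in> ?P"
        then consider "p = ((2, j), (2, 0))" | l where "l \<in> {1..n} - {j}" "p = ((2, l), (0, l))"
          by blast
        then show "fst p \<in> {0..2} \<times> {0..n} - {(1, 0), (0, 0)} - {v} \<and>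
            snd p \<in> {0..2} \<times> {0..n} - {(1, 0), (0, 0)} - {v} \<and> fst p \<noteq> snd p"
          using 3 ij by cases simp_all
      next
        show "{(1, 0), (0, 0)} \<subseteq> {0..2::nat} \<times> {0..n}" by simp
      qed (use 3 in auto)
      moreover have "(1, 0) \<in> {0..2} \<times> {0..n} - {(0, 0)} - {v}" using 3 ij by auto
      ultimately show ?thesis using reply by blast
    qed
  qed
qed simp

theorem theorem4p3:
  fixes m n :: nat
  assumes "n \<ge> m" and "m \<ge> 2"
  shows "(m = 2 \<and> n = 2 \<longrightarrow> has_outcome (star m \<box> star n) Outcome_D) \<and>
         (m = 2 \<and> n \<ge> 3 \<longrightarrow> has_outcome (star m \<box> star n) Outcome_N) \<and>
         (m \<ge> 3 \<longrightarrow> has_outcome (star m \<box> star n) Outcome_S)"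
proof (intro conjI impI)
  have wins: "has_winning_strategy (star k \<box> star l) first p"
    if "forces ({0..k} \<times> {0..l}) (player_goal (star k \<box> star l) p) (first = p) {} {}" for k l first p
    using that by (intro has_winning_strategy_if_forces) (simp add: verts_star_prod)
  have staller_first: "staller_forces m n True {} {}" if "n \<ge> 3"
    by (rule staller_forces_two_rows[of n 1 m 2]) (use assms that in auto)
  show "has_outcome (star m \<box> star n) Outcome_D" if "m = 2 \<and> n = 2"
    using that wins dominator_forces_2_2_first dominator_forces_2_2_second by simp
  show "has_outcome (star m \<box> star n) Outcome_N" if "m = 2 \<and> n \<ge> 3"
    using that wins dominator_forces_2_first staller_first by simp
  show "has_outcome (star m \<box> star n) Outcome_S" if "m \<ge> 3"
    using that assms wins staller_forces_second staller_first by simp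
qed

end
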